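(* Suppose $f$ is convex, the smoothness assumption and the sampling assumption stated in the context hold, $\mathcal{R}(x^0)<\infty$, and $f(x^0)>f^*$. Then the iterates of the random sketch descent (RSD) algorithm satisfy, for every $k\ge0$, $$\mathbf{E}[f(x^k)]-f^*\;\le\;\frac{2\,\mathcal{R}^2(x^0)}{k+2\,\mathcal{R}^2(x^0)/(f(x^0)-f^* )}.$$
   Context: Problem: $f^*=\min_{x\in\mathbb{R}^n} f(x)$ subject to $Ax=b$ (the minimum is assumed attained), where $f:\mathbb{R}^n\to\mathbb{R}$ is differentiable, $A\in\mathbb{R}^{m\times n}$ with $m<n$ (the paper: $m\ll n$), and the feasible set is nonempty. $X^*$ is the set of feasible points $x^*$ with $\nabla f(x^* )\in\mathrm{range}(A^T)$; for convex $f$ it is the set of global minimizers. A point $x^0$ with $Ax^0=b$ is fixed; the feasible set is $x^0+\ker(A)$. Smoothness assumption: there is a symmetric positive semidefinite matrix $M\in\mathbb{R}^{n\times n}$, positive definite on $\ker(A)$ (i.e. $u^TMu>0$ for all nonzero $u\in\ker(A)$), such that $f(y)\le f(x)+\langle\nabla f(x),y-x\rangle+\tfrac12 (y-x)^TM(y-x)$ for all $x,y\in x^0+\ker(A)$. Sketching: $\mathcal{S}$ is a probability distribution on matrices $S\in\mathbb{R}^{n\times p}$ ($p$ may itself be random). $B^\dagger$ denotes the Moore–Penrose pseudo-inverse of $B$. Put $P_S=I_p-(AS)^\dagger(AS)$, $Z_S=SP_S(P_S^TS^TMSP_S)^\dagger P_S^TS^T\in\mathbb{R}^{n\times n}$,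 and $Z=\mathbf{E}_{S\sim\mathcal{S}}[Z_S]$. Sampling assumption: $Z_S$ has finite mean, and $Z$ is positive definite on $\ker(A)$. Norms: $\|u\|_Z=\sqrt{u^TZu}$ for $u\in\mathbb{R}^n$; for $x\in\ker(A)$, $\|x\|_Z^*=\max_{u\in\mathbb{R}^n:\|u\|_Z\le1}\langle x,u\rangle=\sqrt{x^TZ^\dagger x}$. Level-set radius: $\mathcal{R}(x^0)=\max_{\{x\in x^0+\ker(A):\,f(x)\le f(x^0)\}}\ \min_{x^*\in X^*}\|x-x^*\|_Z^*$. RSD algorithm: starting at the feasible $x^0$, at each iteration $k\ge0$ sample $S\sim\mathcal{S}$ (independently of the past) and set $x^{k+1}=x^k-Z_S\nabla f(x^k)$. $\mathbf{E}$ is the expectation over all sampled sketch matrices. *)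

theory Defs
  imports "HOL-Probability.Probability" "Jordan_Normal_Form.Matrix"
begin

no_notation Matrix.vec_index (infixl \<open>$\<close> 100)
no_notation Matrix.scalar_prod (infix \<open>\<bullet>\<close> 70)
unbundle inner_syntax

text \<open>
  Points live in \<^typ>\<open>real^'n\<close>. A sketch matrix has a (random) number of columns which cannot be
  a type parameter, so sketches are of type \<^typ>\<open>real mat\<close>, whose dimensions are part of the value.
  The two representations are related through the enumeration \<^term>\<open>from_nat_into (UNIV :: 'n set)\<close>
  of the finite index type by the numbers below \<^term>\<open>CARD('n)\<close>, with inverse
  \<^term>\<open>to_nat_on (UNIV :: 'n set)\<close>.
\<close>

definition to_jnf_mat :: "real^'c^'r \<Rightarrow> real mat" where
  "to_jnf_mat A = Matrix.mat CARD('r) CARD('c)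
     (\<lambda>(i, j). A $ from_nat_into UNIV i $ from_nat_into UNIV j)"

definition of_jnf_mat :: "real mat \<Rightarrow> real^'c^'r" where
  "of_jnf_mat B = (\<chi> i j. B $$ (to_nat_on UNIV i, to_nat_on UNIV j))"

text \<open>The Moore--Penrose pseudo-inverse, by the four Penrose equations.\<close>

definition is_pinv :: "real mat \<Rightarrow> real mat \<Rightarrow> bool" where
  "is_pinv B X \<longleftrightarrow> X \<in> carrier_mat (dim_col B) (dim_row B) \<and>
     B * X * B = B \<and> X * B * X = X \<and> (B * X)\<^sup>T = B * X \<and> (X * B)\<^sup>T = X * B"

definition pinv :: "real mat \<Rightarrow> real mat" where
  "pinv B = (THE X. is_pinv B X)"

definition sketch_P :: "real^'n^'m \<Rightarrow> real mat \<Rightarrow> real mat" where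
  "sketch_P A S = 1\<^sub>m (dim_col S) - pinv (to_jnf_mat A * S) * (to_jnf_mat A * S)"

definition sketch_Z :: "real^'n^'m \<Rightarrow> real^'n^'n \<Rightarrow> real mat \<Rightarrow> real^'n^'n" where
  "sketch_Z A M S = (let P = sketch_P A S in
     of_jnf_mat (S * P * pinv (P\<^sup>T * S\<^sup>T * to_jnf_mat M * S * P) * P\<^sup>T * S\<^sup>T))"

definition mean_Z :: "real^'n^'m \<Rightarrow> real^'n^'n \<Rightarrow> real mat measure \<Rightarrow> real^'n^'n" where
  "mean_Z A M D = (\<integral>S. sketch_Z A M S \<partial>D)"

definition pos_def_on_ker :: "real^'n^'m \<Rightarrow> real^'n^'n \<Rightarrow> bool" where
  "pos_def_on_ker A Q \<longleftrightarrow> (\<forall>u. A *v u = 0 \<and> u \<noteq> 0 \<longrightarrow> u \<bullet> (Q *v u) > 0)"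

definition grad :: "(real^'n \<Rightarrow> real) \<Rightarrow> real^'n \<Rightarrow> real^'n" where
  "grad f x = (THE g. GDERIV f x :> g)"

definition feasible :: "real^'n^'m \<Rightarrow> real^'m \<Rightarrow> (real^'n) set" where
  "feasible A b = {x. A *v x = b}"

definition opt_val :: "(real^'n \<Rightarrow> real) \<Rightarrow> real^'n^'m \<Rightarrow> real^'m \<Rightarrow> real" where
  "opt_val f A b = (INF x\<in>feasible A b. f x)"

definition opt_set :: "(real^'n \<Rightarrow> real) \<Rightarrow> real^'n^'m \<Rightarrow> real^'m \<Rightarrow> (real^'n) set" where
  "opt_set f A b = {x \<in> feasible A b. grad f x \<in> range (\<lambda>y. Finite_Cartesian_Product.transpose A *v y)}"

definition smooth_wrt :: "(real^'n \<Rightarrow> real) \<Rightarrow> real^'n^'n \<Rightarrow> (real^'n) set \<Rightarrow> bool" where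
  "smooth_wrt f M F \<longleftrightarrow> (\<forall>x\<in>F. \<forall>y\<in>F.
     f y \<le> f x + grad f x \<bullet> (y - x) + 1/2 * ((y - x) \<bullet> (M *v (y - x))))"

definition norm_wrt :: "real^'n^'n \<Rightarrow> real^'n \<Rightarrow> real" where
  "norm_wrt Z u = sqrt (u \<bullet> (Z *v u))"

text \<open>The supremum is over a possibly unbounded set of \<open>u\<close>, but it is a finite maximum whenever
  \<open>Z\<close> is symmetric positive semidefinite and \<open>x\<close> lies in its range; it is only used in this case.\<close>

definition dual_norm_wrt :: "real^'n^'n \<Rightarrow> real^'n \<Rightarrow> real" where
  "dual_norm_wrt Z x = (SUP u\<in>{u. norm_wrt Z u \<le> 1}. x \<bullet> u)"

text \<open>Extended-real valued, so that finiteness of the radius is a genuine condition.\<close>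

definition level_radius ::
  "(real^'n \<Rightarrow> real) \<Rightarrow> real^'n^'m \<Rightarrow> real^'m \<Rightarrow> real^'n^'n \<Rightarrow> real^'n \<Rightarrow> ereal" where
  "level_radius f A b Z x0 = (SUP x\<in>{x \<in> feasible A b. f x \<le> f x0}.
     INF xs\<in>opt_set f A b. ereal (dual_norm_wrt Z (x - xs)))"

primrec rsd :: "(real^'n \<Rightarrow> real) \<Rightarrow> real^'n^'m \<Rightarrow> real^'n^'n \<Rightarrow> real^'n \<Rightarrow>
    (nat \<Rightarrow> real mat) \<Rightarrow> nat \<Rightarrow> real^'n" where
  "rsd f A M x0 S 0 = x0"
| "rsd f A M x0 S (Suc k) =
     rsd f A M x0 S k - sketch_Z A M (S k) *v grad f (rsd f A M x0 S k)"

end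

theory Submission
  imports Defs
begin

text \<open>
  Each sketched matrix \<open>Z\<^sub>T = sketch_Z A M T\<close> is symmetric, has its range in \<open>ker A\<close>, and satisfies
  \<open>Z\<^sub>T M Z\<^sub>T = Z\<^sub>T\<close> (\<open>sketch_Z_structure\<close>). The last identity says that the step \<open>- Z\<^sub>T g\<close> along
  the gradient \<open>g\<close> turns the quadratic upper model of \<open>f\<close> into an exact decrease: the linear term
  contributes \<open>- g \<bullet> Z\<^sub>T g\<close> and the quadratic one half of its opposite, so that the iterates stay
  feasible and \<open>f\<close> drops by at least \<open>g \<bullet> Z\<^sub>T g / 2 \<ge> 0\<close> (\<open>sketch_step\<close>). Since the sketch drawn at
  a step is independent of the past, averaging over it replaces \<open>Z\<^sub>T\<close> by its mean \<open>Z\<close>, and the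
  expected decrease is half the expectation of \<open>\<parallel>g\<parallel>\<^sub>Z\<^sup>2\<close> (\<open>expected_descent\<close>).

  Convexity bounds this quantity from below. The mean \<open>Z\<close> is an inner product on \<open>ker A\<close>
  and vanishes on the orthogonal complement, so the duality inequality
  \<open>g \<bullet> (x - x\<^sup>*) \<le> \<parallel>g\<parallel>\<^sub>Z \<parallel>x - x\<^sup>*\<parallel>\<^sub>Z\<^sup>*\<close> holds for feasible \<open>x, x\<^sup>*\<close>; together with the tangent
  inequality and the choice of the best optimal \<open>x\<^sup>*\<close> it gives \<open>f x - f\<^sup>* \<le> \<parallel>g\<parallel>\<^sub>Z R\<close> on the
  initial level set, which the iterates never leave (\<open>suboptimality_gap_le\<close>).

  With \<open>\<phi> k\<close> the expected gap after \<open>k\<close> steps, these two bounds and Jensen's inequality give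
  \<open>\<phi> (k + 1) \<le> \<phi> k - (\<phi> k)\<^sup>2 / (2 R\<^sup>2)\<close>. In terms of reciprocals this is
  \<open>1 / \<phi> (k + 1) \<ge> 1 / \<phi> k + 1 / (2 R\<^sup>2)\<close>, and summing up is the claimed rate
  (\<open>quadratic_descent_rate\<close>).

  To compute with \<open>Z\<^sub>T\<close> one needs that every real matrix has exactly one Moore--Penrose inverse.
  Existence is reduced to orthogonal projection: a solution \<open>X\<close> of the normal equations
  \<open>B\<^sup>T B X = B\<^sup>T\<close> satisfies two of the Penrose equations, a solution for \<open>B\<^sup>T\<close> yields the other
  two, and a product of both satisfies all four.
\<close>

section \<open>Existence and uniqueness of the Moore--Penrose inverse\<close>

text \<open>
  The orthogonal decomposition of \<open>y\<close> along \<open>a 0, \<dots>, a (k - 1)\<close> for the inner product of the first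
  \<open>r\<close> coordinates. The vectors are plain functions because the number of rows and columns of a
  sketch are values, not types. The induction is Gram--Schmidt: the residual \<open>e\<close> of the new vector
  is the only new direction, and subtracting from the residual of \<open>y\<close> its component along \<open>e\<close>
  preserves the orthogonality to the old vectors.
\<close>

lemma orthogonal_residual_exists:
  fixes a :: "nat \<Rightarrow> nat \<Rightarrow> real"
  shows "\<exists>x e. (\<forall>i. y i = (\<Sum>l<k. x l * a l i) + e i) \<and> (\<forall>j<k. (\<Sum>i<r. a j i * e i) = 0)"
proof (induction k arbitrary: y)
  case 0
  show ?case by auto
next
  case (Suc k)
  obtain c e where c: "\<And>i. a k i = (\<Sum>l<k. c l * a l i) + e i"
    and e: "\<And>j. j < k \<Longrightarrow> (\<Sum>i<r. a j i * e i) = 0"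
    using Suc.IH[of "a k"] by blast
  obtain d z where d: "\<And>i. y i = (\<Sum>l<k. d l * a l i) + z i"
    and z: "\<And>j. j < k \<Longrightarrow> (\<Sum>i<r. a j i * z i) = 0"
    using Suc.IH[of y] by blast
  \<comment> \<open>If \<open>e\<close> vanishes on the first \<open>r\<close> coordinates, the new vector is dependent on the old ones;
    division by zero then yields \<open>t = 0\<close>, which is the right coefficient.\<close>
  define t where "t = (\<Sum>i<r. e i * z i) / (\<Sum>i<r. e i * e i)"
  define z' where "z' i = z i - t * e i" for i
  define x where "x l = (if l = k then t else d l - t * c l)" for l
  have old: "(\<Sum>i<r. a j i * z' i) = 0" if "j < k" for j
  proof -
    have "(\<Sum>i<r. a j i * z' i) = (\<Sum>i<r. a j i * z i) - t * (\<Sum>i<r. a j i * e i)"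
      by (simp add: z'_def algebra_simps sum_subtractf sum_distrib_left)
    then show ?thesis using e z that by simp
  qed
  have new_dir: "(\<Sum>i<r. e i * z' i) = 0"
  proof -
    have split: "(\<Sum>i<r. e i * z' i) = (\<Sum>i<r. e i * z i) - t * (\<Sum>i<r. e i * e i)"
      by (simp add: z'_def algebra_simps sum_subtractf sum_distrib_left)
    show ?thesis
    proof (cases "(\<Sum>i<r. e i * e i) = 0")
      case True
      then have "\<forall>i<r. e i = 0" by (simp add: sum_nonneg_eq_0_iff)
      then show ?thesis by simp
    next
      case False
      then show ?thesis using split by (simp add: t_def)
    qed
  qed
  have "(\<Sum>i<r. a k i * z' i) = (\<Sum>i<r. \<Sum>l<k. c l * (a l i * z' i)) + (\<Sum>i<r. e i * z' i)"
    by (subst c) (simp add: algebra_simps sum.distrib sum_distrib_left)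
  also have "(\<Sum>i<r. \<Sum>l<k. c l * (a l i * z' i)) = (\<Sum>l<k. c l * (\<Sum>i<r. a l i * z' i))"
    by (subst sum.swap) (simp add: sum_distrib_left)
  finally have new: "(\<Sum>i<r. a k i * z' i) = 0"
    using old new_dir by simp
  have "y i = (\<Sum>l<Suc k. x l * a l i) + z' i" for i
  proof -
    have "(\<Sum>l<Suc k. x l * a l i) = (\<Sum>l<k. d l * a l i) - t * (\<Sum>l<k. c l * a l i) + t * a k i"
      by (simp add: x_def algebra_simps sum_subtractf sum_distrib_left)
    then show ?thesis using c[of i] d[of i] by (simp add: z'_def algebra_simps)
  qed
  moreover have "\<forall>j<Suc k. (\<Sum>i<r. a j i * z' i) = 0"
    using old new by (auto simp: less_Suc_eq)
  ultimately show ?case by blast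
qed

lemma mult_mat_assoc:
  fixes P Q R :: "real mat"
  assumes "dim_col P = dim_row Q" "dim_col Q = dim_row R"
  shows "P * Q * R = P * (Q * R)"
  using assms by (intro assoc_mult_mat[of _ "dim_row P" "dim_row Q" _ "dim_row R" _ "dim_col R"]) auto

text \<open>
  Column \<open>q\<close> of \<open>X\<close> holds the coefficients of the projection of the \<open>q\<close>-th unit vector onto the
  column space of \<open>B\<close>.
\<close>

lemma normal_equations_solvable:
  fixes B :: "real mat"
  assumes B: "B \<in> carrier_mat r c"
  obtains X where "X \<in> carrier_mat c r" "B\<^sup>T * (B * X) = B\<^sup>T"
proof -
  have "\<forall>q. \<exists>x. \<forall>j<c. (\<Sum>i<r. B $$ (i, j) * ((if i = q then 1 else 0) - (\<Sum>l<c. x l * B $$ (i, l)))) = 0"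
  proof
    fix q
    obtain x e where x: "\<forall>i. (if i = q then 1 else 0 :: real) = (\<Sum>l<c. x l * B $$ (i, l)) + e i"
      and e: "\<forall>j<c. (\<Sum>i<r. B $$ (i, j) * e i) = 0"
      using orthogonal_residual_exists[where y = "\<lambda>i. if i = q then 1 else 0" and k = c
          and a = "\<lambda>l i. B $$ (i, l)" and r = r]
      by blast
    have "(if i = q then 1 else 0) - (\<Sum>l<c. x l * B $$ (i, l)) = e i" for i
      using x[rule_format, of i] by linarith
    then show "\<exists>x. \<forall>j<c. (\<Sum>i<r. B $$ (i, j) *
        ((if i = q then 1 else 0) - (\<Sum>l<c. x l * B $$ (i, l)))) = 0"
      using e by (intro exI[of _ x]) simp
  qed
  from choice[OF this] obtain x where x: "\<And>q j. j < c \<Longrightarrow>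
      (\<Sum>i<r. B $$ (i, j) * ((if i = q then 1 else 0) - (\<Sum>l<c. x q l * B $$ (i, l)))) = 0"
    by blast
  define X where "X = Matrix.mat c r (\<lambda>(l, q). x q l)"
  have X: "X \<in> carrier_mat c r" by (simp add: X_def)
  have "B\<^sup>T * (B * X) = B\<^sup>T"
  proof (rule eq_matI)
    fix j q assume "j < dim_row B\<^sup>T" "q < dim_col B\<^sup>T"
    then have j: "j < c" and q: "q < r" using B by auto
    have "(B\<^sup>T * (B * X)) $$ (j, q) = (\<Sum>i<r. B $$ (i, j) * (\<Sum>l<c. x q l * B $$ (i, l)))"
      using B j q by (simp add: X_def scalar_prod_def lessThan_atLeast0 mult.commute)
    also have "\<dots> = (\<Sum>i<r. B $$ (i, j) * (if i = q then 1 else 0))"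
      using x[OF j, of q] by (simp only: right_diff_distrib sum_subtractf) 
    also have "\<dots> = B $$ (q, j)"
      using q by (simp add: if_distrib[of "\<lambda>t. _ * t"] cong: if_cong)
    finally show "(B\<^sup>T * (B * X)) $$ (j, q) = B\<^sup>T $$ (j, q)" using B j q by simp
  qed (use B X in auto)
  then show ?thesis using X that by blast
qed

text \<open>
  The normal equations make \<open>(B X)\<^sup>T = (B X)\<^sup>T (B X)\<close>, whose right-hand side is symmetric; hence
  \<open>B X\<close> is symmetric, and transposing the normal equations then reads \<open>B X B = B\<close>.
\<close>

lemma one_three_inverse_exists:
  fixes B :: "real mat"
  assumes B: "B \<in> carrier_mat r c"
  obtains X where "X \<in> carrier_mat c r" "B * X * B = B" "(B * X)\<^sup>T = B * X"
proof -
  obtain X where X: "X \<in> carrier_mat c r" and n: "B\<^sup>T * (B * X) = B\<^sup>T"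
    using normal_equations_solvable[OF B] .
  have BX: "B * X \<in> carrier_mat r r" using B X by auto
  have "(B * X)\<^sup>T = X\<^sup>T * (B\<^sup>T * (B * X))"
    using n transpose_mult[OF B X] by simp
  also have "\<dots> = (X\<^sup>T * B\<^sup>T) * (B * X)"
    using B X by (intro assoc_mult_mat[symmetric]) auto
  also have "\<dots> = (B * X)\<^sup>T * (B * X)"
    by (simp add: transpose_mult[OF B X])
  finally have sq: "(B * X)\<^sup>T = (B * X)\<^sup>T * (B * X)" .
  have "((B * X)\<^sup>T * (B * X))\<^sup>T = (B * X)\<^sup>T * (B * X)"
    using BX by (subst transpose_mult[of _ r r _ r]) auto
  then have sym: "(B * X)\<^sup>T = B * X" using sq by (metis Matrix.transpose_transpose)
  have "(B\<^sup>T * (B * X))\<^sup>T = (B * X)\<^sup>T * B"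
    using B BX by (subst transpose_mult[of _ c r _ r]) auto
  then have "B * X * B = B" using n sym by simp
  then show ?thesis using X sym that by blast
qed

text \<open>
  If \<open>Y\<close> satisfies the first and third Penrose equation and \<open>V\<close> the first and fourth, then
  \<open>X = V B Y\<close> satisfies all four, because \<open>B X = B Y\<close> and \<open>X B = V B\<close>. For \<open>V\<close> one takes the
  transpose of a matrix that satisfies the first and third equation for \<open>B\<^sup>T\<close>.
\<close>

lemma pinv_exists:
  fixes B :: "real mat"
  shows "\<exists>X. is_pinv B X"
proof -
  define r c where "r = dim_row B" and "c = dim_col B"
  have B: "B \<in> carrier_mat r c" by (simp add: r_def c_def)
  then have BT: "B\<^sup>T \<in> carrier_mat c r" by simp
  obtain Y where Y: "Y \<in> carrier_mat c r" "B * Y * B = B" "(B * Y)\<^sup>T = B * Y"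
    using one_three_inverse_exists[OF B] .
  obtain W where W: "W \<in> carrier_mat r c" "B\<^sup>T * W * B\<^sup>T = B\<^sup>T" "(B\<^sup>T * W)\<^sup>T = B\<^sup>T * W"
    using one_three_inverse_exists[OF BT] .
  define V where "V = W\<^sup>T"
  have V: "V \<in> carrier_mat c r" using W by (simp add: V_def)
  have VB: "V * B = B\<^sup>T * W"
    using W(3) transpose_mult[OF BT W(1)] by (simp add: V_def)
  have VBs: "(V * B)\<^sup>T = V * B" using VB W(3) by simp
  have "(B\<^sup>T * W * B\<^sup>T)\<^sup>T = B * (V * B)"
    using B W(1) W(3) VB by (subst transpose_mult[of _ c c _ r]) auto
  then have BVB: "B * (V * B) = B" using W(2) by simp
  have YB: "B * (Y * B) = B" using Y B by (metis assoc_mult_mat)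
  define X where "X = V * (B * Y)"
  have X: "X \<in> carrier_mat c r" using V B Y by (simp add: X_def)
  have "B * X = (B * (V * B)) * Y"
    using B V Y(1) by (simp add: mult_mat_assoc X_def)
  then have BX: "B * X = B * Y" using BVB by simp
  have "X * B = (V * B) * (Y * B)"
    using B V Y(1) by (simp add: mult_mat_assoc X_def)
  also have "\<dots> = V * (B * (Y * B))" using B V Y(1) by (simp add: mult_mat_assoc)
  finally have XB: "X * B = V * B" using YB by simp
  have "X * B * X = V * B * (V * (B * Y))" by (simp only: XB) (simp only: X_def)
  also have "\<dots> = V * ((B * (V * B)) * Y)"
    using B V Y(1) by (simp add: mult_mat_assoc)
  also have "\<dots> = X" by (simp add: BVB X_def)
  finally have "X * B * X = X" .
  moreover have "B * X * B = B" using BX Y(2) by simp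
  moreover have "(B * X)\<^sup>T = B * X" using BX Y(3) by simp
  moreover have "(X * B)\<^sup>T = X * B" using XB VBs by simp
  ultimately have "is_pinv B X"
    unfolding is_pinv_def using X r_def c_def by blast
  then show ?thesis by blast
qed

text \<open>
  Transposing \<open>B Y B X = B X\<close>, a product of two symmetric factors, swaps the factors and gives
  \<open>B X = B Y\<close>. Similarly \<open>X B = Y B\<close>, and then \<open>X = X B X = Y B Y = Y\<close>.
\<close>

lemma pinv_unique:
  fixes B :: "real mat"
  assumes "is_pinv B X" "is_pinv B Y"
  shows "X = Y"
proof -
  define r c where "r = dim_row B" and "c = dim_col B"
  have B: "B \<in> carrier_mat r c" by (simp add: r_def c_def)
  have X: "X \<in> carrier_mat c r" "B * X * B = B" "X * B * X = X" "(B * X)\<^sup>T = B * X" "(X * B)\<^sup>T = X * B"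
    using assms(1) by (auto simp: is_pinv_def r_def c_def)
  have Y: "Y \<in> carrier_mat c r" "B * Y * B = B" "Y * B * Y = Y" "(B * Y)\<^sup>T = B * Y" "(Y * B)\<^sup>T = Y * B"
    using assms(2) by (auto simp: is_pinv_def r_def c_def)
  have "B * X = (B * Y * B * X)\<^sup>T" using X Y by simp
  also have "B * Y * B * X = (B * Y) * (B * X)" using B X(1) Y(1) by (simp add: mult_mat_assoc)
  also have "\<dots>\<^sup>T = (B * X) * (B * Y)"
    using B X(1) Y(1) X(4) Y(4) by (subst transpose_mult[of _ r r _ r]) auto
  also have "\<dots> = (B * X * B) * Y" using B X(1) Y(1) by (simp add: mult_mat_assoc)
  finally have BXY: "B * X = B * Y" using X(2) by simp
  have "X * B = (X * (B * Y * B))\<^sup>T" using X Y by simp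
  also have "X * (B * Y * B) = (X * B) * (Y * B)" using B X(1) Y(1) by (simp add: mult_mat_assoc)
  also have "\<dots>\<^sup>T = (Y * B) * (X * B)"
    using B X(1) Y(1) X(5) Y(5) by (subst transpose_mult[of _ c c _ c]) auto
  also have "\<dots> = Y * (B * X * B)" using B X(1) Y(1) by (simp add: mult_mat_assoc)
  finally have XYB: "X * B = Y * B" using X(2) by simp
  have "X = Y * B * X" using X(3) XYB by simp
  also have "\<dots> = Y * (B * Y)" using B X(1) Y(1) by (simp add: mult_mat_assoc BXY)
  also have "\<dots> = Y" using B Y(1,3) by (simp add: mult_mat_assoc)
  finally show ?thesis .
qed

lemma is_pinv_pinv: "is_pinv B (pinv B)"
  unfolding pinv_def by (rule theI') (use pinv_exists pinv_unique in blast)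

lemma pinv_carrier: "B \<in> carrier_mat r c \<Longrightarrow> pinv B \<in> carrier_mat c r"
  using is_pinv_pinv[of B] by (auto simp: is_pinv_def)

text \<open>
  The transpose of \<open>pinv B\<close> satisfies the Penrose equations of \<open>B\<^sup>T = B\<close>.
\<close>

lemma pinv_symmetric:
  assumes B: "B \<in> carrier_mat r r" and sym: "B\<^sup>T = B"
  shows "(pinv B)\<^sup>T = pinv B"
proof (rule pinv_unique)
  show "is_pinv B (pinv B)" by (rule is_pinv_pinv)
  define X where "X = pinv B"
  have X: "X \<in> carrier_mat r r" using pinv_carrier[OF B] by (simp add: X_def)
  have eqs: "B * X * B = B" "X * B * X = X" "(B * X)\<^sup>T = B * X" "(X * B)\<^sup>T = X * B"
    using is_pinv_pinv[of B] by (auto simp: is_pinv_def X_def)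
  have BX: "B * X\<^sup>T = X * B"
    using eqs(4) transpose_mult[OF X B] sym by simp
  have XB: "X\<^sup>T * B = B * X"
    using eqs(3) transpose_mult[OF B X] sym by simp
  have "B * X\<^sup>T * B = (B * X * B)\<^sup>T"
    using B X sym by (subst transpose_mult[of _ r r _ r]) (auto simp: eqs(3) mult_mat_assoc XB)
  then have 1: "B * X\<^sup>T * B = B" by (simp add: eqs(1) sym)
  have "X\<^sup>T * B * X\<^sup>T = (X * B * X)\<^sup>T"
    using B X sym by (subst transpose_mult[of _ r r _ r]) (auto simp: eqs(4) mult_mat_assoc BX)
  then have 2: "X\<^sup>T * B * X\<^sup>T = X\<^sup>T" by (simp add: eqs(2))
  show "is_pinv B (pinv B)\<^sup>T"
    unfolding is_pinv_def X_def[symmetric] using 1 2 B X eqs BX XB by auto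
qed

section \<open>Transfer from matrices with explicit dimensions to typed ones\<close>

lemma to_nat_on_bij: "bij_betw (to_nat_on (UNIV :: 'k::finite set)) UNIV {..<CARD('k)}"
  using to_nat_on_finite[of "UNIV :: 'k set"] by simp

lemma to_nat_on_less: "to_nat_on UNIV (i :: 'k::finite) < CARD('k)"
  using bij_betwE[OF to_nat_on_bij] by auto

lemma to_jnf_mat_carrier: "to_jnf_mat (A :: real^'c^'r) \<in> carrier_mat CARD('r) CARD('c)"
  by (simp add: to_jnf_mat_def)

lemma of_jnf_mat_to_jnf_mat: "of_jnf_mat (to_jnf_mat A) = (A :: real^'c^'r)"
  by (simp add: of_jnf_mat_def to_jnf_mat_def to_nat_on_less Finite_Cartesian_Product.vec_eq_iff)

lemma of_jnf_mat_mult: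
  assumes "F \<in> carrier_mat CARD('r) CARD('k)" "G \<in> carrier_mat CARD('k) CARD('c)"
  shows "(of_jnf_mat (F * G) :: real^'c^'r) = (of_jnf_mat F :: real^'k^'r) ** of_jnf_mat G"
proof -
  have "(of_jnf_mat (F * G) :: real^'c^'r) $ i $ j = ((of_jnf_mat F :: real^'k^'r) ** of_jnf_mat G) $ i $ j"
    for i j
  proof -
    let ?h = "\<lambda>l. F $$ (to_nat_on UNIV i, l) * G $$ (l, to_nat_on UNIV j)"
    have "(of_jnf_mat (F * G) :: real^'c^'r) $ i $ j = (\<Sum>l<CARD('k). ?h l)"
      using assms to_nat_on_less[of i] to_nat_on_less[of j]
      by (simp add: of_jnf_mat_def scalar_prod_def lessThan_atLeast0)
    also have "\<dots> = (\<Sum>q\<in>UNIV. ?h (to_nat_on (UNIV :: 'k set) q))"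
      by (rule sum.reindex_bij_betw[OF to_nat_on_bij, symmetric])
    finally show ?thesis by (simp add: of_jnf_mat_def matrix_matrix_mult_def)
  qed
  then show ?thesis by (simp add: Finite_Cartesian_Product.vec_eq_iff)
qed

lemma of_jnf_mat_transpose:
  assumes "F \<in> carrier_mat CARD('r) CARD('c)"
  shows "(of_jnf_mat F\<^sup>T :: real^'r^'c) = Finite_Cartesian_Product.transpose (of_jnf_mat F)"
  using assms by (simp add: of_jnf_mat_def Finite_Cartesian_Product.transpose_def to_nat_on_less Finite_Cartesian_Product.vec_eq_iff)

lemma to_jnf_mat_transpose:
  "(to_jnf_mat A)\<^sup>T = to_jnf_mat (Finite_Cartesian_Product.transpose A)"
  by (rule eq_matI) (auto simp: to_jnf_mat_def Finite_Cartesian_Product.transpose_def)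

lemma of_jnf_mat_zero: "(of_jnf_mat (0\<^sub>m CARD('r) CARD('c)) :: real^'c^'r) = 0"
  by (simp add: of_jnf_mat_def to_nat_on_less Finite_Cartesian_Product.vec_eq_iff)

section \<open>Algebra of a single sketch\<close>

context
  fixes A :: "real^'n^'m" and M :: "real^'n^'n" and T :: "real mat"
  assumes rows: "dim_row T = CARD('n)"
    and M_sym: "Finite_Cartesian_Product.transpose M = M"
begin

lemma sketch_P_carrier: "sketch_P A T \<in> carrier_mat (dim_col T) (dim_col T)"
proof -
  have B: "to_jnf_mat A * T \<in> carrier_mat CARD('m) (dim_col T)"
    using to_jnf_mat_carrier[of A] by auto
  show ?thesis
    unfolding sketch_P_def by (rule minus_carrier_mat, rule mult_carrier_mat[OF pinv_carrier[OF B] B])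
qed

text \<open>
  \<open>P = I - B\<^sup>\<dagger> B\<close> with \<open>B = A T\<close> projects onto \<open>ker B\<close>, since \<open>B B\<^sup>\<dagger> B = B\<close>.
\<close>

lemma sketch_P_annihilated:
  "to_jnf_mat A * (T * sketch_P A T) = 0\<^sub>m CARD('m) (dim_col T)"
proof -
  define B where "B = to_jnf_mat A * T"
  have B: "B \<in> carrier_mat CARD('m) (dim_col T)"
    using to_jnf_mat_carrier[of A] by (auto simp: B_def)
  have X: "pinv B \<in> carrier_mat (dim_col T) CARD('m)" using pinv_carrier[OF B] .
  have "to_jnf_mat A * (T * sketch_P A T) = B * (1\<^sub>m (dim_col T) - pinv B * B)"
    using rows to_jnf_mat_carrier[of A] sketch_P_carrier mult_mat_assoc[of "to_jnf_mat A" T "sketch_P A T"]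
    by (simp add: B_def) (simp add: sketch_P_def)
  also have "\<dots> = B - B * (pinv B * B)"
    using B X by (subst mult_minus_distrib_mat[of _ "CARD('m)" "dim_col T" _ "dim_col T"]) auto
  also have "B * (pinv B * B) = B"
    using is_pinv_pinv[of B] B X by (simp add: is_pinv_def mult_mat_assoc)
  finally show ?thesis using B by simp
qed

text \<open>
  With \<open>C = T P\<close> and \<open>N = C\<^sup>T M C\<close> one has \<open>Z\<^sub>T = C N\<^sup>\<dagger> C\<^sup>T\<close>. All three claims are read off from
  this form: \<open>A C = 0\<close>; \<open>N\<close>, and with it \<open>N\<^sup>\<dagger>\<close>, is symmetric; and
  \<open>Z\<^sub>T M Z\<^sub>T = C (N\<^sup>\<dagger> N N\<^sup>\<dagger>) C\<^sup>T\<close>.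
\<close>

lemma sketch_Z_structure:
  shows A_sketch_Z: "A ** sketch_Z A M T = 0"
    and sketch_Z_symmetric: "Finite_Cartesian_Product.transpose (sketch_Z A M T) = sketch_Z A M T"
    and sketch_Z_M_sketch_Z: "sketch_Z A M T ** M ** sketch_Z A M T = sketch_Z A M T"
proof -
  define p where "p = dim_col T"
  define P where "P = sketch_P A T"
  define C where "C = T * P"
  define At where "At = to_jnf_mat A"
  define Mt where "Mt = to_jnf_mat M"
  define N where "N = C\<^sup>T * (Mt * C)"
  define Q where "Q = pinv N"
  define Zt where "Zt = C * (Q * C\<^sup>T)"
  have P: "P \<in> carrier_mat p p" using sketch_P_carrier by (simp add: P_def p_def)
  have T: "T \<in> carrier_mat CARD('n) p" using rows by (auto simp: p_def)
  have C: "C \<in> carrier_mat CARD('n) p" using T P by (simp add: C_def)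
  have CT: "C\<^sup>T = P\<^sup>T * T\<^sup>T" using transpose_mult[OF T P] by (simp add: C_def)
  have At: "At \<in> carrier_mat CARD('m) CARD('n)" by (simp add: At_def to_jnf_mat_carrier)
  have Mt: "Mt \<in> carrier_mat CARD('n) CARD('n)" by (simp add: Mt_def to_jnf_mat_carrier)
  have MtT: "Mt\<^sup>T = Mt" by (simp add: Mt_def to_jnf_mat_transpose M_sym)
  have N: "N \<in> carrier_mat p p" using C Mt by (simp add: N_def)
  have Q: "Q \<in> carrier_mat p p" using pinv_carrier[OF N] by (simp add: Q_def)
  have Zt: "Zt \<in> carrier_mat CARD('n) CARD('n)" using C Q by (simp add: Zt_def)
  have Z_eq: "sketch_Z A M T = of_jnf_mat Zt"
  proof -
    have "P\<^sup>T * T\<^sup>T * Mt * T * P = N"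
      using C Mt T P by (simp add: N_def CT) (simp add: C_def mult_mat_assoc)
    moreover have "T * P * Q * P\<^sup>T * T\<^sup>T = Zt"
      using C Q T P by (simp add: Zt_def CT) (simp add: C_def mult_mat_assoc)
    ultimately show ?thesis
      by (simp add: sketch_Z_def P_def[symmetric] Mt_def[symmetric] Q_def[symmetric] Let_def)
  qed
  have NT: "N\<^sup>T = N"
    unfolding N_def using C Mt MtT
    by (subst transpose_mult[of _ p "CARD('n)" _ p])
       (auto simp: transpose_mult[of _ "CARD('n)" "CARD('n)" _ p] mult_mat_assoc)
  have QT: "Q\<^sup>T = Q" unfolding Q_def by (rule pinv_symmetric[OF N NT])
  have ZtT: "Zt\<^sup>T = Zt"
    unfolding Zt_def using C Q QT
    by (subst transpose_mult[of _ "CARD('n)" p _ "CARD('n)"])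
       (auto simp: transpose_mult[of _ p p _ "CARD('n)"] mult_mat_assoc)
  have AC: "At * C = 0\<^sub>m CARD('m) p"
    using sketch_P_annihilated by (simp add: At_def C_def P_def p_def)
  have "At * Zt = (At * C) * (Q * C\<^sup>T)" using At C Q by (simp add: Zt_def mult_mat_assoc)
  also have "\<dots> = 0\<^sub>m CARD('m) CARD('n)" using AC C Q by simp
  finally have AZ: "At * Zt = 0\<^sub>m CARD('m) CARD('n)" .
  have "Q * N * Q = Q" using is_pinv_pinv[of N] by (simp add: is_pinv_def Q_def)
  then have "Zt = C * ((Q * N * Q) * C\<^sup>T)" by (simp add: Zt_def)
  also have "\<dots> = Zt * Mt * Zt" using C Q Mt by (simp add: Zt_def N_def mult_mat_assoc)
  finally have ZMZ: "Zt * Mt * Zt = Zt" by simp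
  show "A ** sketch_Z A M T = 0"
    using of_jnf_mat_mult[OF At Zt] AZ
    by (simp add: Z_eq At_def of_jnf_mat_to_jnf_mat of_jnf_mat_zero)
  show "Finite_Cartesian_Product.transpose (sketch_Z A M T) = sketch_Z A M T"
    using of_jnf_mat_transpose[OF Zt] ZtT by (simp add: Z_eq)
  have ZM: "Zt * Mt \<in> carrier_mat CARD('n) CARD('n)" using Zt Mt by simp
  show "sketch_Z A M T ** M ** sketch_Z A M T = sketch_Z A M T"
    using of_jnf_mat_mult[OF ZM Zt] of_jnf_mat_mult[OF Zt Mt] ZMZ
    by (simp add: Z_eq Mt_def of_jnf_mat_to_jnf_mat)
qed

end

section \<open>Gradients of differentiable and convex functions\<close>

text \<open>
  By the Riesz representation, the value at \<open>1\<close> of the adjoint of the derivative is a gradient;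
  uniqueness of derivatives makes the definite description well defined.
\<close>

lemma grad_has_derivative:
  fixes f :: "real^'n \<Rightarrow> real"
  assumes "f differentiable (at x)"
  shows "(f has_derivative (\<lambda>h. grad f x \<bullet> h)) (at x)"
proof -
  obtain L where L: "(f has_derivative L) (at x)"
    using assms by (auto simp: differentiable_def)
  then have lin: "linear L" by (rule has_derivative_linear)
  define g where "g = adjoint L 1"
  have "L = (\<lambda>h. h \<bullet> g)"
    using adjoint_works[OF lin, of _ 1] by (auto simp: g_def)
  then have g: "GDERIV f x :> g" using L by (simp add: gderiv_def)
  have "g' = g" if "GDERIV f x :> g'" for g'
  proof -
    have "(\<lambda>h. h \<bullet> g') = (\<lambda>h. h \<bullet> g)"
      by (rule has_derivative_unique[OF that[unfolded gderiv_def] g[unfolded gderiv_def]])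
    then have "h \<bullet> g' = h \<bullet> g" for h by (rule fun_cong)
    from this[of "g' - g"] have "(g' - g) \<bullet> (g' - g) = 0" by (simp only: inner_diff_right)
    then show ?thesis by simp
  qed
  then have "grad f x = g" unfolding grad_def using g by (intro the_equality)
  then show ?thesis using g by (simp add: gderiv_def inner_commute)
qed

lemma grad_line_derivative:
  fixes f :: "real^'n \<Rightarrow> real"
  assumes "f differentiable (at x)"
  shows "((\<lambda>t. f (x + t *\<^sub>R v)) has_real_derivative grad f x \<bullet> v) (at 0)"
proof -
  have "((\<lambda>t. x + t *\<^sub>R v) has_derivative (\<lambda>t. t *\<^sub>R v)) (at 0)"
    by (auto intro!: derivative_eq_intros)
  moreover have "(f has_derivative (\<lambda>h. grad f x \<bullet> h)) (at (x + 0 *\<^sub>R v))"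
    using grad_has_derivative[OF assms] by simp
  ultimately have "((\<lambda>t. f (x + t *\<^sub>R v)) has_derivative (\<lambda>t. grad f x \<bullet> (t *\<^sub>R v))) (at 0)"
    by (rule has_derivative_compose)
  then show ?thesis by (simp add: has_field_derivative_def mult_commute_abs)
qed

text \<open>
  The one-dimensional tangent inequality, for the restriction of \<open>f\<close> to the line through \<open>x\<close>
  and \<open>y\<close>.
\<close>

lemma convex_above_gradient_tangent:
  fixes f :: "real^'n \<Rightarrow> real"
  assumes diff: "f differentiable (at x)" and conv: "convex_on UNIV f"
  shows "f x + grad f x \<bullet> (y - x) \<le> f y"
proof -
  have "convex_on UNIV (\<lambda>t::real. f (x + t *\<^sub>R (y - x)))"
  proof (rule convex_onI)
    fix t a c :: real assume t: "0 < t" "t < 1"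
    have "x + ((1 - t) *\<^sub>R a + t *\<^sub>R c) *\<^sub>R (y - x)
        = (1 - t) *\<^sub>R (x + a *\<^sub>R (y - x)) + t *\<^sub>R (x + c *\<^sub>R (y - x))"
      by (simp add: algebra_simps)
    then show "f (x + ((1 - t) *\<^sub>R a + t *\<^sub>R c) *\<^sub>R (y - x))
        \<le> (1 - t) * f (x + a *\<^sub>R (y - x)) + t * f (x + c *\<^sub>R (y - x))"
      using convex_onD[OF conv, of t] t by simp
  qed simp
  from convex_on_imp_above_tangent[OF this, of 0 1 "grad f x \<bullet> (y - x)"]
  show ?thesis using grad_line_derivative[OF diff, of "y - x"] by simp
qed

text \<open>
  Every component of the gradient is a pointwise limit of difference quotients, which are
  continuous in \<open>x\<close>.
\<close>

lemma grad_borel_measurable: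
  fixes f :: "real^'n \<Rightarrow> real"
  assumes diff: "\<And>x. f differentiable (at x)"
  shows "grad f \<in> borel_measurable borel"
  unfolding borel_measurable_euclidean_space[of "grad f"]
proof
  fix v :: "real^'n"
  have "continuous_on UNIV f"
    using diff by (simp add: differentiable_imp_continuous_within continuous_on_eq_continuous_within)
  then have f: "f \<in> borel_measurable borel" by (rule borel_measurable_continuous_onI)
  let ?h = "\<lambda>n. inverse (real (Suc n))"
  have h0: "filterlim ?h (at 0) sequentially"
    using LIMSEQ_inverse_real_of_nat by (rule filterlim_atI) simp
  show "(\<lambda>x. grad f x \<bullet> v) \<in> borel_measurable borel"
  proof (rule borel_measurable_LIMSEQ_real)
    fix x :: "real^'n"
    have "((\<lambda>t. (f (x + t *\<^sub>R v) - f x) / t) \<longlongrightarrow> grad f x \<bullet> v) (at 0)"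
      using grad_line_derivative[OF diff, of x v] by (simp add: DERIV_def)
    from filterlim_compose[OF this h0]
    show "(\<lambda>n. (f (x + ?h n *\<^sub>R v) - f x) / ?h n) \<longlonglongrightarrow> grad f x \<bullet> v" .
  next
    fix n
    have [measurable]: "(\<lambda>x. f (x + ?h n *\<^sub>R v)) \<in> borel_measurable borel"
      using measurable_compose[OF _ f, of "\<lambda>x. x + ?h n *\<^sub>R v"] by simp
    show "(\<lambda>x. (f (x + ?h n *\<^sub>R v) - f x) / ?h n) \<in> borel_measurable borel"
      using f by measurable
  qed
qed

section \<open>Duality for a form supported on the kernel\<close>

lemma nonneg_quadratic_discriminant:
  fixes a b c :: real
  assumes "\<And>t. 0 \<le> a * t\<^sup>2 + 2 * b * t + c" and "0 \<le> a"
  shows "b\<^sup>2 \<le> a * c"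
proof (cases "a = 0")
  case True
  have "b = 0"
  proof (rule ccontr)
    assume "b \<noteq> 0"
    \<comment> \<open>At this \<open>t\<close> the affine function \<open>2 b t + c\<close> has the value \<open>-1\<close>.\<close>
    then show False using assms(1)[of "- (c + 1) / (2 * b)"] True by (simp add: field_simps)
  qed
  then show ?thesis using True by simp
next
  case False
  then have "a * (- b / a)\<^sup>2 + 2 * b * (- b / a) + c = c - b\<^sup>2 / a"
    by (simp add: field_simps power2_eq_square)
  then have "b\<^sup>2 / a \<le> c" using assms(1)[of "- b / a"] by simp
  then show ?thesis using False assms(2) by (simp add: field_simps)
qed

text \<open>
  The properties of the averaged matrix \<open>Z\<close> on which the duality rests. They say that \<open>Z\<close> is an
  inner product on \<open>ker A\<close> and, by symmetry and \<open>into_ker\<close>, vanishes on the orthogonal complement.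
\<close>

locale kernel_form =
  fixes A :: "real^'n^'m" and Z :: "real^'n^'n"
  assumes sym: "u \<bullet> (Z *v v) = v \<bullet> (Z *v u)"
    and psd: "0 \<le> u \<bullet> (Z *v u)"
    and into_ker: "A *v (Z *v u) = 0"
    and pd: "pos_def_on_ker A Z"
begin

lemma norm_wrt_power2: "(norm_wrt Z u)\<^sup>2 = u \<bullet> (Z *v u)"
  by (simp add: norm_wrt_def psd)

lemma norm_wrt_nonneg: "0 \<le> norm_wrt Z u"
  by (simp add: norm_wrt_def psd)

lemma norm_wrt_scaleR: "norm_wrt Z (c *\<^sub>R u) = \<bar>c\<bar> * norm_wrt Z u"
proof -
  have "(c *\<^sub>R u) \<bullet> (Z *v (c *\<^sub>R u)) = c\<^sup>2 * (u \<bullet> (Z *v u))"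
    by (simp add: matrix_vector_mult_scaleR power2_eq_square)
  then show ?thesis by (simp add: norm_wrt_def real_sqrt_mult)
qed

text \<open>
  The discriminant of \<open>t \<mapsto> \<parallel>v + t u\<parallel>\<^sub>Z\<^sup>2 \<ge> 0\<close>. It is used for
  vectors outside \<open>ker A\<close> as well, such as gradients.
\<close>

lemma Cauchy_Schwarz: "v \<bullet> (Z *v u) \<le> norm_wrt Z v * norm_wrt Z u"
proof -
  have "0 \<le> (u \<bullet> (Z *v u)) * t\<^sup>2 + 2 * (v \<bullet> (Z *v u)) * t + v \<bullet> (Z *v v)" for t
  proof -
    have "(v + t *\<^sub>R u) \<bullet> (Z *v (v + t *\<^sub>R u))
        = (u \<bullet> (Z *v u)) * t\<^sup>2 + 2 * (v \<bullet> (Z *v u)) * t + v \<bullet> (Z *v v)"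
      using sym[of u v]
      by (simp add: matrix_vector_right_distrib matrix_vector_mult_scaleR inner_add_left
          inner_add_right power2_eq_square algebra_simps)
    then show ?thesis using psd[of "v + t *\<^sub>R u"] by simp
  qed
  from nonneg_quadratic_discriminant[OF this psd]
  have "(v \<bullet> (Z *v u))\<^sup>2 \<le> (norm_wrt Z v * norm_wrt Z u)\<^sup>2"
    by (simp add: power_mult_distrib norm_wrt_power2 mult.commute)
  then show ?thesis by (rule power2_le_imp_le) (simp add: norm_wrt_nonneg)
qed

text \<open>
  Positive definiteness makes \<open>Z\<close> injective on \<open>ker A\<close>, which it maps to itself; by dimension it
  is onto.
\<close>

lemma kernel_subset_range:
  assumes "A *v x = 0"
  obtains v where "x = Z *v v"
proof -
  let ?K = "{x. A *v x = 0}"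
  have K: "subspace ?K"
    by (auto simp: subspace_def matrix_vector_right_distrib matrix_vector_mult_scaleR)
  have "inj_on ((*v) Z) (span ?K)"
  proof (rule inj_onI)
    fix u v assume "u \<in> span ?K" "v \<in> span ?K" and eq: "Z *v u = Z *v v"
    moreover have "span ?K = ?K" using K by (simp only: span_eq_iff)
    ultimately have "u \<in> ?K" "v \<in> ?K" by auto
    then have "A *v (u - v) = 0" by (simp add: matrix_vector_mult_diff_distrib)
    moreover have "(u - v) \<bullet> (Z *v (u - v)) = 0"
      using eq by (simp add: matrix_vector_mult_diff_distrib)
    ultimately have "u - v = 0" using pd unfolding pos_def_on_ker_def by fastforce
    then show "u = v" by simp
  qed
  then have "dim ((*v) Z ` ?K) = dim ?K"
    by (intro dim_image_eq) (auto simp: matrix_vector_mul_linear)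
  moreover have "subspace ((*v) Z ` ?K)"
    by (intro linear_subspace_image K) simp
  moreover have "(*v) Z ` ?K \<subseteq> ?K" using into_ker by auto
  ultimately have "(*v) Z ` ?K = ?K" using K by (intro subspace_dim_equal) auto
  then have "x \<in> (*v) Z ` ?K" using assms by simp
  then show ?thesis using that by blast
qed

text \<open>
  The supremum in \<^const>\<open>dual_norm_wrt\<close> says something about its set only if that is bounded. The set
  of all \<open>u\<close> with \<open>\<parallel>u\<parallel>\<^sub>Z \<le> 1\<close> is unbounded where \<open>Z\<close> is singular, but \<open>x = Z v\<close> bounds \<open>x \<bullet> u\<close>
  by \<open>\<parallel>v\<parallel>\<^sub>Z\<close>.
\<close>

lemma dual_norm_bdd_above:
  assumes "A *v x = 0"
  shows "bdd_above ((\<lambda>u. x \<bullet> u) ` {u. norm_wrt Z u \<le> 1})"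
proof -
  obtain v where x: "x = Z *v v" using kernel_subset_range[OF assms] .
  have "x \<bullet> u \<le> norm_wrt Z v" if "norm_wrt Z u \<le> 1" for u
  proof -
    have "x \<bullet> u = u \<bullet> (Z *v v)" by (simp add: x inner_commute)
    also have "\<dots> \<le> norm_wrt Z u * norm_wrt Z v" by (rule Cauchy_Schwarz)
    also have "\<dots> \<le> 1 * norm_wrt Z v" by (intro mult_right_mono that norm_wrt_nonneg)
    finally show ?thesis by simp
  qed
  then show ?thesis by (intro bdd_aboveI[where M = "norm_wrt Z v"]) auto
qed

lemma dual_norm_nonneg:
  assumes "A *v x = 0"
  shows "0 \<le> dual_norm_wrt Z x"
proof -
  have "x \<bullet> 0 \<le> dual_norm_wrt Z x"
    unfolding dual_norm_wrt_def
    by (rule cSUP_upper[OF _ dual_norm_bdd_above[OF assms]]) (simp add: norm_wrt_def)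
  then show ?thesis by simp
qed

text \<open>
  Normalising \<open>g\<close> gives a competitor in the supremum. A \<open>g\<close> with \<open>\<parallel>g\<parallel>\<^sub>Z = 0\<close> cannot be normalised;
  for it the claim is the Cauchy--Schwarz inequality with \<open>x = Z v\<close>.
\<close>

lemma inner_le_norm_dual_norm:
  assumes "A *v x = 0"
  shows "g \<bullet> x \<le> norm_wrt Z g * dual_norm_wrt Z x"
proof (cases "norm_wrt Z g = 0")
  case True
  obtain v where x: "x = Z *v v" using kernel_subset_range[OF assms] .
  then show ?thesis using Cauchy_Schwarz[of g v] True by simp
next
  case False
  then have pos: "0 < norm_wrt Z g" using norm_wrt_nonneg[of g] by simp
  have "x \<bullet> ((1 / norm_wrt Z g) *\<^sub>R g) \<le> dual_norm_wrt Z x"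
    unfolding dual_norm_wrt_def
    by (rule cSUP_upper[OF _ dual_norm_bdd_above[OF assms]]) (use pos in \<open>simp add: norm_wrt_scaleR\<close>)
  then show ?thesis using pos by (simp add: field_simps inner_commute)
qed

end

section \<open>The optimality gap on the initial level set\<close>

text \<open>
  At a point of \<^const>\<open>opt_set\<close> the gradient lies in the range of \<open>A\<^sup>T\<close>, hence is orthogonal to all
  feasible directions, and the tangent inequality has no linear term.
\<close>

lemma opt_set_minimal:
  fixes f :: "real^'n \<Rightarrow> real"
  assumes diff: "\<And>x. f differentiable (at x)" and conv: "convex_on UNIV f"
    and xs: "xs \<in> opt_set f A b" and y: "y \<in> feasible A b"
  shows "f xs \<le> f y"
proof -
  obtain w where w: "grad f xs = Finite_Cartesian_Product.transpose A *v w"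
    using xs by (auto simp: opt_set_def)
  have "A *v (y - xs) = 0"
    using xs y by (simp add: opt_set_def feasible_def matrix_vector_mult_diff_distrib)
  then have "grad f xs \<bullet> (y - xs) = 0"
    by (simp add: w transpose_matrix_vector dot_lmul_matrix)
  then show ?thesis using convex_above_gradient_tangent[OF diff conv, of xs y] by simp
qed

text \<open>
  Every optimal \<open>x\<^sup>*\<close> gives \<open>f x - f\<^sup>* \<le> \<parallel>g\<parallel>\<^sub>Z \<parallel>x - x\<^sup>*\<parallel>\<^sub>Z\<^sup>*\<close>; dividing by \<open>\<parallel>g\<parallel>\<^sub>Z\<close> and taking the
  infimum over \<open>x\<^sup>*\<close> puts the radius on the right. Finiteness of the radius is what makes this a
  real inequality and what guarantees that an optimal point exists, the infimum over the
  empty set being \<open>\<infinity>\<close>.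
\<close>

lemma (in kernel_form) suboptimality_gap_le:
  fixes f :: "real^'n \<Rightarrow> real"
  assumes diff: "\<And>x. f differentiable (at x)" and conv: "convex_on UNIV f"
    and R: "R = level_radius f A b Z x0" "R < \<infinity>"
    and x: "x \<in> feasible A b" "f x \<le> f x0"
  shows "0 \<le> real_of_ereal R"
    and "f x - opt_val f A b \<le> norm_wrt Z (grad f x) * real_of_ereal R"
proof -
  let ?I = "INF xs\<in>opt_set f A b. ereal (dual_norm_wrt Z (x - xs))"
  have I_le: "?I \<le> R"
    unfolding R level_radius_def by (rule SUP_upper2[of x]) (use x in auto)
  have ker: "A *v (x - xs) = 0" if "xs \<in> opt_set f A b" for xs
    using that x by (simp add: opt_set_def feasible_def matrix_vector_mult_diff_distrib)
  have "0 \<le> ?I"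
    by (rule INF_greatest) (simp add: dual_norm_nonneg ker)
  then have R0: "0 \<le> R" using I_le by (rule order_trans)
  then show "0 \<le> real_of_ereal R" by (simp add: real_of_ereal_pos)
  have R_real: "R = ereal (real_of_ereal R)" using R0 R(2) by (cases R) auto
  have gap: "f x - opt_val f A b \<le> norm_wrt Z (grad f x) * dual_norm_wrt Z (x - xs)"
    if xs: "xs \<in> opt_set f A b" for xs
  proof -
    have "f xs \<le> opt_val f A b"
      unfolding opt_val_def
      by (rule cINF_greatest) (use x in \<open>auto intro: opt_set_minimal[OF diff conv xs]\<close>)
    moreover have "f x - f xs \<le> grad f x \<bullet> (x - xs)"
      using convex_above_gradient_tangent[OF diff conv, of x xs] by (simp add: inner_diff_right)
    moreover have "grad f x \<bullet> (x - xs) \<le> norm_wrt Z (grad f x) * dual_norm_wrt Z (x - xs)"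
      by (rule inner_le_norm_dual_norm[OF ker[OF xs]])
    ultimately show ?thesis by linarith
  qed
  have "opt_set f A b \<noteq> {}"
  proof
    assume "opt_set f A b = {}"
    then have "?I = \<infinity>" by (simp add: top_ereal_def)
    then show False using I_le R(2) by simp
  qed
  then obtain xs where xs: "xs \<in> opt_set f A b" by blast
  show "f x - opt_val f A b \<le> norm_wrt Z (grad f x) * real_of_ereal R"
  proof (cases "norm_wrt Z (grad f x) = 0")
    case True
    then show ?thesis using gap[OF xs] by simp
  next
    case False
    then have pos: "0 < norm_wrt Z (grad f x)" using norm_wrt_nonneg[of "grad f x"] by simp
    have "ereal ((f x - opt_val f A b) / norm_wrt Z (grad f x)) \<le> ?I"
      by (rule INF_greatest) (use gap pos in \<open>simp add: field_simps\<close>)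
    also have "\<dots> \<le> ereal (real_of_ereal R)" using I_le R_real by simp
    finally have "(f x - opt_val f A b) / norm_wrt Z (grad f x) \<le> real_of_ereal R" by simp
    then show ?thesis using pos by (simp add: field_simps)
  qed
qed

section \<open>The rate implied by a quadratic decrease\<close>

text \<open>
  The reciprocals \<open>t = c / \<phi> k\<close> grow by at least one in every step, because
  \<open>(t - 1) / t\<^sup>2 \<le> 1 / (t + 1)\<close>. The case \<open>\<phi> k = 0\<close>, where the reciprocal is meaningless, is
  immediate.
\<close>

lemma quadratic_descent_rate:
  fixes \<phi> :: "nat \<Rightarrow> real"
  assumes c: "0 < c" and start: "0 < \<phi> 0" and nonneg: "\<And>k. 0 \<le> \<phi> k"
    and descent: "\<And>k. \<phi> (Suc k) \<le> \<phi> k - (\<phi> k)\<^sup>2 / c"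
  shows "\<phi> k \<le> c / (real k + c / \<phi> 0)"
proof (induction k)
  case 0
  show ?case using c start by simp
next
  case (Suc k)
  define a where "a = real k + c / \<phi> 0"
  have a: "0 < a" using c start by (simp add: a_def add_nonneg_pos)
  have "\<phi> (Suc k) \<le> c / (a + 1)"
  proof (cases "\<phi> k = 0")
    case True
    then have "\<phi> (Suc k) \<le> 0" using descent[of k] by simp
    also have "0 \<le> c / (a + 1)" using a c by simp
    finally show ?thesis .
  next
    case False
    define t where "t = c / \<phi> k"
    have \<phi>: "0 < \<phi> k" using False nonneg[of k] by simp
    have "a \<le> t" using Suc.IH \<phi> a by (simp add: t_def a_def[symmetric] field_simps)
    then have t: "0 < t" using a by simp
    have "\<phi> k = c / t" using c \<phi> by (simp add: t_def)
    moreover have "c / t - (c / t)\<^sup>2 / c = c * ((t - 1) / t\<^sup>2)"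
      using c t by (simp add: field_simps power2_eq_square)
    ultimately have "\<phi> k - (\<phi> k)\<^sup>2 / c = c * ((t - 1) / t\<^sup>2)" by simp
    also have "(t - 1) / t\<^sup>2 \<le> 1 / (t + 1)"
      using t by (simp add: field_simps power2_eq_square)
    then have "c * ((t - 1) / t\<^sup>2) \<le> c * (1 / (t + 1))"
      using c by (intro mult_left_mono) auto
    also have "\<dots> \<le> c / (a + 1)"
      using \<open>a \<le> t\<close> a c by (simp add: frac_le)
    finally show ?thesis using descent[of k] by linarith
  qed
  then show ?case by (simp add: a_def algebra_simps)
qed

section \<open>Expectations, independence and measurability\<close>

text \<open>
  Conditioning on \<open>X\<close>: by independence the joint law is a product, so Fubini's theorem integrates
  out \<open>Y\<close> first.
\<close>

lemma (in prob_space)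
  fixes h :: "'b \<times> 'b \<Rightarrow> real"
  assumes indep: "indep_var N X L Y" and h: "h \<in> borel_measurable (N \<Otimes>\<^sub>M L)"
    and int: "integrable M (\<lambda>w. h (X w, Y w))"
  shows integrable_partial_expectation: "integrable M (\<lambda>w. \<integral>y. h (X w, y) \<partial>distr M L Y)"
    and expectation_partial_expectation:
      "(\<integral>w. \<integral>y. h (X w, y) \<partial>distr M L Y \<partial>M) = (\<integral>w. h (X w, Y w) \<partial>M)"
proof -
  have X: "X \<in> M \<rightarrow>\<^sub>M N" using indep by (rule indep_var_rv1)
  have Y: "Y \<in> M \<rightarrow>\<^sub>M L" using indep by (rule indep_var_rv2)
  interpret X: prob_space "distr M N X" using X by (rule prob_space_distr)
  interpret Y: prob_space "distr M L Y" using Y by (rule prob_space_distr)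
  interpret P: pair_sigma_finite "distr M N X" "distr M L Y" ..
  have joint: "distr M N X \<Otimes>\<^sub>M distr M L Y = distr M (N \<Otimes>\<^sub>M L) (\<lambda>w. (X w, Y w))"
    using indep indep_var_distribution_eq by blast
  have XY: "(\<lambda>w. (X w, Y w)) \<in> M \<rightarrow>\<^sub>M N \<Otimes>\<^sub>M L" using X Y by simp
  have "integrable (distr M (N \<Otimes>\<^sub>M L) (\<lambda>w. (X w, Y w))) h"
    using int by (simp add: integrable_distr_eq[OF XY h])
  then have int': "integrable (distr M N X \<Otimes>\<^sub>M distr M L Y) h" by (simp add: joint)
  from P.integrable_fst'[OF int']
  have fst: "integrable (distr M N X) (\<lambda>x. \<integral>y. h (x, y) \<partial>distr M L Y)" .
  then have meas: "(\<lambda>x. \<integral>y. h (x, y) \<partial>distr M L Y) \<in> borel_measurable N" by simp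
  show "integrable M (\<lambda>w. \<integral>y. h (X w, y) \<partial>distr M L Y)"
    using fst by (simp add: integrable_distr_eq[OF X meas])
  have "(\<integral>w. \<integral>y. h (X w, y) \<partial>distr M L Y \<partial>M) = (\<integral>x. \<integral>y. h (x, y) \<partial>distr M L Y \<partial>distr M N X)"
    by (rule integral_distr[OF X meas, symmetric])
  also have "\<dots> = integral\<^sup>L (distr M (N \<Otimes>\<^sub>M L) (\<lambda>w. (X w, Y w))) h"
    using P.integral_fst'[OF int'] by (simp add: joint)
  also have "\<dots> = (\<integral>w. h (X w, Y w) \<partial>M)"
    by (rule integral_distr[OF XY h])
  finally show "(\<integral>w. \<integral>y. h (X w, y) \<partial>distr M L Y \<partial>M) = (\<integral>w. h (X w, Y w) \<partial>M)" .
qed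

lemma (in prob_space) expectation_square_le:
  fixes X :: "'a \<Rightarrow> real"
  assumes "integrable M X" "integrable M (\<lambda>w. (X w)\<^sup>2)"
  shows "(expectation X)\<^sup>2 \<le> expectation (\<lambda>w. (X w)\<^sup>2)"
  using variance_eq[OF assms] variance_positive[of X] by linarith

lemma continuous_on_matrix_vector_mult:
  "continuous_on UNIV (\<lambda>p :: (real^'n^'m) \<times> (real^'n). fst p *v snd p)"
  unfolding matrix_vector_mult_def by (intro continuous_intros)

lemma borel_measurable_matrix_vector_mult:
  fixes F :: "'a \<Rightarrow> real^'n^'m"
  assumes "F \<in> borel_measurable N" "G \<in> borel_measurable N"
  shows "(\<lambda>w. F w *v G w) \<in> borel_measurable N"
  using assms continuous_on_matrix_vector_mult by (rule borel_measurable_continuous_Pair)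

lemma symmetric_matrix_inner:
  fixes Q :: "real^'n^'n"
  assumes "Finite_Cartesian_Product.transpose Q = Q"
  shows "u \<bullet> (Q *v v) = v \<bullet> (Q *v u)"
  using dot_lmul_matrix[of u Q v] transpose_matrix_vector[of Q u] assms by (simp add: inner_commute)

lemma rsd_cong:
  assumes "\<And>i. i < k \<Longrightarrow> X i = Y i"
  shows "rsd f A M x0 X k = rsd f A M x0 Y k"
  using assms by (induction k) auto

section \<open>One step of the method and its trajectories\<close>

locale sketch_descent =
  fixes f :: "real^'n \<Rightarrow> real" and A :: "real^'n^'m" and b :: "real^'m"
    and M :: "real^'n^'n" and x0 :: "real^'n" and D :: "real mat measure"
  assumes differentiable: "\<And>x. f differentiable (at x)"
    and convex: "convex_on UNIV f"
    and start: "x0 \<in> feasible A b"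
    and attained: "\<exists>xs\<in>feasible A b. \<forall>x\<in>feasible A b. f xs \<le> f x"
    and M_sym: "Finite_Cartesian_Product.transpose M = M"
    and M_psd: "\<And>u. 0 \<le> u \<bullet> (M *v u)"
    and smooth: "smooth_wrt f M (feasible A b)"
    and D_prob: "prob_space D"
    and D_rows: "space D \<subseteq> {T. dim_row T = CARD('n)}"
    and Z_integrable: "integrable D (\<lambda>T. sketch_Z A M T)"
    and Z_pd: "pos_def_on_ker A (mean_Z A M D)"
begin

context
  fixes T assumes T: "T \<in> space D"
begin

lemma rows: "dim_row T = CARD('n)"
  using T D_rows by blast

lemma A_sketch_Z_vec: "A *v (sketch_Z A M T *v u) = 0"
  using A_sketch_Z[OF rows M_sym, of A] by (simp add: matrix_vector_mul_assoc)

lemma sketch_Z_inner_sym: "u \<bullet> (sketch_Z A M T *v v) = v \<bullet> (sketch_Z A M T *v u)"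
  by (rule symmetric_matrix_inner[OF sketch_Z_symmetric[OF rows M_sym]])

text \<open>
  The identity \<open>Z\<^sub>T M Z\<^sub>T = Z\<^sub>T\<close> as an identity of quadratic forms. It also yields semidefiniteness
  of \<open>Z\<^sub>T\<close> from that of \<open>M\<close>.
\<close>

lemma sketch_Z_inner_M:
  "(sketch_Z A M T *v u) \<bullet> (M *v (sketch_Z A M T *v u)) = u \<bullet> (sketch_Z A M T *v u)"
proof -
  let ?Z = "sketch_Z A M T"
  have "(?Z *v u) \<bullet> (M *v (?Z *v u)) = (M *v (?Z *v u)) \<bullet> (?Z *v u)"
    by (rule inner_commute)
  also have "\<dots> = u \<bullet> (?Z *v (M *v (?Z *v u)))"
    by (rule sketch_Z_inner_sym)
  also have "?Z *v (M *v (?Z *v u)) = ?Z *v u"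
    using sketch_Z_M_sketch_Z[OF rows M_sym, of A] by (simp add: matrix_vector_mul_assoc matrix_mul_assoc)
  finally show ?thesis .
qed

lemma sketch_Z_psd: "0 \<le> u \<bullet> (sketch_Z A M T *v u)"
  using M_psd[of "sketch_Z A M T *v u"] by (simp add: sketch_Z_inner_M)

text \<open>
  In the quadratic upper model at \<open>x\<close> the displacement \<open>- Z\<^sub>T g\<close> has the linear term \<open>- g \<bullet> Z\<^sub>T g\<close>
  and the quadratic term \<open>g \<bullet> Z\<^sub>T g / 2\<close>, by \<open>sketch_Z_inner_M\<close>.
\<close>

lemma sketch_step:
  assumes x: "x \<in> feasible A b"
  defines "y \<equiv> x - sketch_Z A M T *v grad f x"
  shows "y \<in> feasible A b"
    and "f y \<le> f x - 1/2 * (grad f x \<bullet> (sketch_Z A M T *v grad f x))"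
proof -
  let ?d = "sketch_Z A M T *v grad f x"
  show y: "y \<in> feasible A b"
    using x by (simp add: y_def feasible_def matrix_vector_mult_diff_distrib A_sketch_Z_vec)
  have "f y \<le> f x + grad f x \<bullet> (y - x) + 1/2 * ((y - x) \<bullet> (M *v (y - x)))"
    using smooth x y unfolding smooth_wrt_def by blast
  moreover have "y - x = - ?d" by (simp add: y_def)
  moreover have "(- ?d) \<bullet> (M *v (- ?d)) = ?d \<bullet> (M *v ?d)"
    using matrix_vector_mult_scaleR[of M "-1" ?d] by simp
  ultimately show "f y \<le> f x - 1/2 * (grad f x \<bullet> ?d)"
    using sketch_Z_inner_M[of "grad f x"] by simp
qed

end

lemma bounded_linear_mean_Z:
  assumes "bounded_linear h"
  shows "h (mean_Z A M D) = (\<integral>T. h (sketch_Z A M T) \<partial>D)"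
  unfolding mean_Z_def by (rule integral_bounded_linear[OF assms Z_integrable, symmetric])

lemma bounded_linear_apply: "bounded_linear (\<lambda>Q :: real^'n^'k. Q *v u)"
  unfolding linear_conv_bounded_linear[symmetric]
  by (rule linearI) (simp_all add: matrix_vector_mult_add_rdistrib scaleR_matrix_vector_assoc)

lemma mean_Z_form: "u \<bullet> (mean_Z A M D *v v) = (\<integral>T. u \<bullet> (sketch_Z A M T *v v) \<partial>D)"
  by (rule bounded_linear_mean_Z)
     (rule bounded_linear_compose[OF bounded_linear_inner_right bounded_linear_apply])

text \<open>
  Symmetry, semidefiniteness and the range condition are linear in the matrix, so they pass from
  the sketches to the mean.
\<close>

sublocale kernel_form A "mean_Z A M D"
proof
  show "u \<bullet> (mean_Z A M D *v v) = v \<bullet> (mean_Z A M D *v u)" for u v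
    unfolding mean_Z_form by (rule Bochner_Integration.integral_cong) (auto intro: sketch_Z_inner_sym)
  show "0 \<le> u \<bullet> (mean_Z A M D *v u)" for u
    unfolding mean_Z_form by (rule Bochner_Integration.integral_nonneg_AE) (auto intro: sketch_Z_psd)
  show "A *v (mean_Z A M D *v u) = 0" for u
  proof -
    have "bounded_linear (\<lambda>Q. A *v (Q *v u))"
      by (rule bounded_linear_compose[OF _ bounded_linear_apply]) (simp add: linear_conv_bounded_linear[symmetric])
    from bounded_linear_mean_Z[OF this]
    have "A *v (mean_Z A M D *v u) = (\<integral>T. A *v (sketch_Z A M T *v u) \<partial>D)" .
    also have "\<dots> = (\<integral>T. 0 \<partial>D)"
      by (rule Bochner_Integration.integral_cong) (auto intro: A_sketch_Z_vec)
    finally show ?thesis by simp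
  qed
qed (rule Z_pd)

lemma opt_val_le: "x \<in> feasible A b \<Longrightarrow> opt_val f A b \<le> f x"
  unfolding opt_val_def using attained by (auto intro!: cINF_lower bdd_belowI2)

lemma rsd_trajectory:
  assumes X: "\<And>i. X i \<in> space D"
  defines "x \<equiv> rsd f A M x0 X"
  shows rsd_feasible: "x k \<in> feasible A b"
    and rsd_descent: "f (x (Suc k)) \<le> f (x k) - 1/2 * (grad f (x k) \<bullet> (sketch_Z A M (X k) *v grad f (x k)))"
    and rsd_level: "f (x k) \<le> f x0"
proof -
  show feas: "x k \<in> feasible A b" for k
    by (induction k) (simp_all add: x_def start sketch_step(1)[OF X])
  show desc: "f (x (Suc k)) \<le> f (x k) - 1/2 * (grad f (x k) \<bullet> (sketch_Z A M (X k) *v grad f (x k)))" for k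
    using sketch_step(2)[OF X feas[of k]] by (simp add: x_def)
  show "f (x k) \<le> f x0"
  proof (induction k)
    case 0
    then show ?case by (simp add: x_def)
  next
    case (Suc k)
    then show ?case using desc[of k] sketch_Z_psd[OF X[of k], of "grad f (x k)"] by linarith
  qed
qed

lemma grad_measurable: "grad f \<in> borel_measurable borel"
  by (rule grad_borel_measurable[OF differentiable])

lemma f_measurable: "f \<in> borel_measurable borel"
  using differentiable
  by (simp add: borel_measurable_continuous_onI differentiable_imp_continuous_within
      continuous_on_eq_continuous_within)

lemma sketch_Z_measurable: "sketch_Z A M \<in> borel_measurable D"
  using Z_integrable by (rule borel_measurable_integrable)

text \<open>
  The iterate is viewed as a function of the first \<open>K\<close> sketches, with \<open>K\<close> fixed during the
  induction on \<open>k\<close> so that all iterates live on one product space.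
\<close>

lemma rsd_measurable:
  assumes "k \<le> K"
  shows "(\<lambda>X. rsd f A M x0 X k) \<in> borel_measurable (PiM {..<K} (\<lambda>_. D))"
  using assms
proof (induction k)
  case 0
  show ?case by simp
next
  case (Suc k)
  have x: "(\<lambda>X. rsd f A M x0 X k) \<in> borel_measurable (PiM {..<K} (\<lambda>_. D))"
    using Suc by simp
  have "(\<lambda>X. X k) \<in> PiM {..<K} (\<lambda>_. D) \<rightarrow>\<^sub>M D"
    using Suc.prems by (intro measurable_component_singleton) simp
  from borel_measurable_matrix_vector_mult[OF measurable_compose[OF this sketch_Z_measurable]
      measurable_compose[OF x grad_measurable]]
  show ?case using x by simp
qed

end

section \<open>Expected decrease of the random iterates\<close>

locale random_sketch_descent = sketch_descent f A b M x0 D + prob_space \<Omega>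
  for f :: "real^'n \<Rightarrow> real" and A :: "real^'n^'m" and b :: "real^'m"
    and M :: "real^'n^'n" and x0 :: "real^'n" and D :: "real mat measure" and \<Omega> :: "'w measure" +
  fixes S :: "nat \<Rightarrow> 'w \<Rightarrow> real mat"
  assumes S_indep: "indep_vars (\<lambda>_. D) S UNIV"
    and S_distr: "\<And>i. distr \<Omega> D (S i) = D"
begin

definition iterate :: "nat \<Rightarrow> 'w \<Rightarrow> real^'n" where
  "iterate k w = rsd f A M x0 (\<lambda>i. S i w) k"

lemma S_measurable: "S i \<in> \<Omega> \<rightarrow>\<^sub>M D"
  using S_indep by (simp add: indep_vars_def)

text \<open>
  The sketches with index in \<open>I\<close> as one random variable. The past and the present sketch of a step
  are both of this form, which gives them the common type that independence of two variables
  presupposes.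
\<close>

definition sketches :: "nat set \<Rightarrow> 'w \<Rightarrow> nat \<Rightarrow> real mat" where
  "sketches I w = restrict (\<lambda>i. S i w) I"

lemma past_indep_present:
  "indep_var (PiM {..<k} (\<lambda>_. D)) (sketches {..<k}) (PiM {k} (\<lambda>_. D)) (sketches {k})"
  unfolding sketches_def by (rule indep_var_restrict[OF S_indep]) auto

lemma iterate_eq_rsd_past: "iterate k w = rsd f A M x0 (sketches {..<k} w) k"
  unfolding iterate_def sketches_def by (rule rsd_cong) simp

lemma iterate_measurable: "iterate k \<in> borel_measurable \<Omega>"
  unfolding iterate_eq_rsd_past
  by (rule measurable_compose[OF indep_var_rv1[OF past_indep_present] rsd_measurable]) simp

context
  fixes w assumes w: "w \<in> space \<Omega>"
begin

lemma S_in_space: "S i w \<in> space D"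
  using measurable_space[OF S_measurable w] .

lemma iterate_feasible: "iterate k w \<in> feasible A b"
  unfolding iterate_def by (rule rsd_feasible[OF S_in_space])

lemma iterate_level: "f (iterate k w) \<le> f x0"
  unfolding iterate_def by (rule rsd_level[OF S_in_space])

lemma iterate_descent:
  "f (iterate (Suc k) w) \<le> f (iterate k w)
    - 1/2 * (grad f (iterate k w) \<bullet> (sketch_Z A M (S k w) *v grad f (iterate k w)))"
  unfolding iterate_def by (rule rsd_descent[OF S_in_space])

end

lemma integrable_f_iterate: "integrable \<Omega> (\<lambda>w. f (iterate k w))"
proof (rule integrable_const_bound)
  show "AE w in \<Omega>. norm (f (iterate k w)) \<le> \<bar>f x0\<bar> + \<bar>opt_val f A b\<bar>"
  proof (rule AE_I2)
    fix w assume "w \<in> space \<Omega>"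
    then show "norm (f (iterate k w)) \<le> \<bar>f x0\<bar> + \<bar>opt_val f A b\<bar>"
      using iterate_level[of w k] opt_val_le[OF iterate_feasible[of w k]] by (simp add: abs_if)
  qed
qed (rule measurable_compose[OF iterate_measurable f_measurable])

lemma integrable_gap_square: "integrable \<Omega> (\<lambda>w. (f (iterate k w) - opt_val f A b)\<^sup>2)"
proof (rule integrable_const_bound)
  show "AE w in \<Omega>. norm ((f (iterate k w) - opt_val f A b)\<^sup>2) \<le> (f x0 - opt_val f A b)\<^sup>2"
  proof (rule AE_I2)
    fix w assume "w \<in> space \<Omega>"
    then show "norm ((f (iterate k w) - opt_val f A b)\<^sup>2) \<le> (f x0 - opt_val f A b)\<^sup>2"
      using iterate_level[of w k] opt_val_le[OF iterate_feasible[of w k]] by (simp add: power_mono)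
  qed
  show "(\<lambda>w. (f (iterate k w) - opt_val f A b)\<^sup>2) \<in> borel_measurable \<Omega>"
    using measurable_compose[OF iterate_measurable f_measurable] by simp
qed

text \<open>
  The gradient at the current iterate depends on the past sketches only, so integrating out the
  present sketch turns \<open>g \<bullet> Z\<^sub>T g\<close> into \<open>\<parallel>g\<parallel>\<^sub>Z\<^sup>2\<close>. Integrability comes for free: \<open>g \<bullet> Z\<^sub>T g\<close> is nonnegative
  and bounded by twice the decrease of \<open>f\<close>, which is integrable.
\<close>

lemma
  shows integrable_grad_norm: "integrable \<Omega> (\<lambda>w. (norm_wrt (mean_Z A M D) (grad f (iterate k w)))\<^sup>2)"
    and expected_descent: "expectation (\<lambda>w. f (iterate (Suc k) w)) \<le> expectation (\<lambda>w. f (iterate k w))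
      - 1/2 * expectation (\<lambda>w. (norm_wrt (mean_Z A M D) (grad f (iterate k w)))\<^sup>2)"
proof -
  define past where "past = PiM {..<k} (\<lambda>_. D)"
  define present where "present = PiM {k} (\<lambda>_. D)"
  define h where "h = (\<lambda>(X, Y). grad f (rsd f A M x0 X k) \<bullet> (sketch_Z A M (Y k) *v grad f (rsd f A M x0 X k)))"
  have g: "(\<lambda>p. grad f (rsd f A M x0 (fst p) k)) \<in> borel_measurable (past \<Otimes>\<^sub>M present)"
    unfolding past_def
    by (rule measurable_compose[OF measurable_compose[OF measurable_fst rsd_measurable] grad_measurable]) simp
  have comp: "(\<lambda>Y. Y k) \<in> present \<rightarrow>\<^sub>M D"
    unfolding present_def by (rule measurable_component_singleton) simp
  have Zm: "(\<lambda>p. sketch_Z A M (snd p k)) \<in> borel_measurable (past \<Otimes>\<^sub>M present)"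
    by (rule measurable_compose[OF measurable_compose[OF measurable_snd comp] sketch_Z_measurable])
  have h: "h \<in> borel_measurable (past \<Otimes>\<^sub>M present)"
    unfolding h_def case_prod_beta
    by (rule borel_measurable_inner[OF g borel_measurable_matrix_vector_mult[OF Zm g]])
  note indep = past_indep_present[of k, folded past_def present_def]
  have h_eq: "h (sketches {..<k} w, sketches {k} w)
      = grad f (iterate k w) \<bullet> (sketch_Z A M (S k w) *v grad f (iterate k w))" for w
    by (simp add: h_def iterate_eq_rsd_past) (simp add: sketches_def)
  have h_bounds: "0 \<le> h (sketches {..<k} w, sketches {k} w)"
    "h (sketches {..<k} w, sketches {k} w) \<le> 2 * (f (iterate k w) - f (iterate (Suc k) w))"
    if "w \<in> space \<Omega>" for w
    using sketch_Z_psd[OF S_in_space[OF that]] iterate_descent[OF that, of k] by (simp_all add: h_eq)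
  have bound_int: "integrable \<Omega> (\<lambda>w. 2 * (f (iterate k w) - f (iterate (Suc k) w)))"
    using integrable_f_iterate by simp
  have int: "integrable \<Omega> (\<lambda>w. h (sketches {..<k} w, sketches {k} w))"
  proof (rule Bochner_Integration.integrable_bound[OF bound_int])
    show "(\<lambda>w. h (sketches {..<k} w, sketches {k} w)) \<in> borel_measurable \<Omega>"
      by (rule measurable_compose[OF measurable_Pair[OF indep_var_rv1[OF indep] indep_var_rv2[OF indep]] h])
    show "AE w in \<Omega>. norm (h (sketches {..<k} w, sketches {k} w)) \<le> norm (2 * (f (iterate k w) - f (iterate (Suc k) w)))"
      by (rule AE_I2) (use h_bounds in fastforce)
  qed
  \<comment> \<open>Integrating out the present sketch, whose law is \<open>D\<close>.\<close>
  have partial: "(\<integral>Y. h (sketches {..<k} w, Y) \<partial>distr \<Omega> present (sketches {k}))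
      = (norm_wrt (mean_Z A M D) (grad f (iterate k w)))\<^sup>2" for w
  proof -
    let ?g = "grad f (iterate k w)"
    have form: "(\<lambda>T. ?g \<bullet> (sketch_Z A M T *v ?g)) \<in> borel_measurable D"
      by (intro borel_measurable_inner borel_measurable_matrix_vector_mult sketch_Z_measurable) simp_all
    have "(\<integral>Y. h (sketches {..<k} w, Y) \<partial>distr \<Omega> present (sketches {k}))
        = (\<integral>Y. ?g \<bullet> (sketch_Z A M (Y k) *v ?g) \<partial>distr \<Omega> present (sketches {k}))"
      by (simp add: h_def iterate_eq_rsd_past)
    also have "\<dots> = (\<integral>v. ?g \<bullet> (sketch_Z A M (sketches {k} v k) *v ?g) \<partial>\<Omega>)"
      by (rule integral_distr[OF indep_var_rv2[OF indep] measurable_compose[OF comp form]])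
    also have "\<dots> = (\<integral>v. ?g \<bullet> (sketch_Z A M (S k v) *v ?g) \<partial>\<Omega>)"
      by (simp add: sketches_def)
    also have "\<dots> = (\<integral>T. ?g \<bullet> (sketch_Z A M T *v ?g) \<partial>distr \<Omega> D (S k))"
      by (rule integral_distr[OF S_measurable form, symmetric])
    finally show ?thesis by (simp add: S_distr norm_wrt_power2 mean_Z_form)
  qed
  show "integrable \<Omega> (\<lambda>w. (norm_wrt (mean_Z A M D) (grad f (iterate k w)))\<^sup>2)"
    using integrable_partial_expectation[OF indep h int] by (simp add: partial)
  have "expectation (\<lambda>w. (norm_wrt (mean_Z A M D) (grad f (iterate k w)))\<^sup>2)
      = expectation (\<lambda>w. h (sketches {..<k} w, sketches {k} w))"
    using expectation_partial_expectation[OF indep h int] by (simp add: partial)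
  also have "\<dots> \<le> expectation (\<lambda>w. 2 * (f (iterate k w) - f (iterate (Suc k) w)))"
    by (rule integral_mono[OF int bound_int h_bounds(2)])
  also have "\<dots> = 2 * (expectation (\<lambda>w. f (iterate k w)) - expectation (\<lambda>w. f (iterate (Suc k) w)))"
    using integrable_f_iterate by simp
  finally show "expectation (\<lambda>w. f (iterate (Suc k) w)) \<le> expectation (\<lambda>w. f (iterate k w))
      - 1/2 * expectation (\<lambda>w. (norm_wrt (mean_Z A M D) (grad f (iterate k w)))\<^sup>2)"
    by simp
qed

text \<open>
  The expected decrease is half the mean of \<open>\<parallel>g\<parallel>\<^sub>Z\<^sup>2\<close>, which dominates the mean of the squared gap
  divided by \<open>R\<^sup>2\<close>; by Jensen's inequality this is at least the squared mean gap divided by \<open>R\<^sup>2\<close>.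
\<close>

lemma expected_gap_recurrence:
  assumes R: "R = level_radius f A b (mean_Z A M D) x0" "R < \<infinity>" and R_pos: "0 < real_of_ereal R"
  defines "\<phi> \<equiv> \<lambda>k. expectation (\<lambda>w. f (iterate k w)) - opt_val f A b"
  shows "0 \<le> \<phi> k" and "\<phi> (Suc k) \<le> \<phi> k - (\<phi> k)\<^sup>2 / (2 * (real_of_ereal R)\<^sup>2)"
proof -
  let ?gap = "\<lambda>w. f (iterate k w) - opt_val f A b"
  let ?n = "\<lambda>w. norm_wrt (mean_Z A M D) (grad f (iterate k w))"
  let ?r = "real_of_ereal R"
  have gap_int: "integrable \<Omega> ?gap" using integrable_f_iterate by simp
  have \<phi>: "\<phi> k = expectation ?gap"
    using integrable_f_iterate by (simp add: \<phi>_def prob_space)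
  show "0 \<le> \<phi> k"
    unfolding \<phi> by (rule Bochner_Integration.integral_nonneg_AE)
      (auto intro: opt_val_le iterate_feasible)
  have sq_le: "(?gap w)\<^sup>2 \<le> ?r\<^sup>2 * (?n w)\<^sup>2" if w: "w \<in> space \<Omega>" for w
  proof -
    have "?gap w \<le> ?n w * ?r"
      by (rule suboptimality_gap_le(2)[OF differentiable convex R iterate_feasible[OF w] iterate_level[OF w]])
    moreover have "0 \<le> ?gap w" using opt_val_le[OF iterate_feasible[OF w]] by simp
    ultimately have "(?gap w)\<^sup>2 \<le> (?n w * ?r)\<^sup>2" by (rule power_mono)
    then show ?thesis by (simp add: power_mult_distrib mult.commute)
  qed
  have "(\<phi> k)\<^sup>2 \<le> expectation (\<lambda>w. (?gap w)\<^sup>2)"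
    unfolding \<phi> by (rule expectation_square_le[OF gap_int integrable_gap_square])
  also have "\<dots> \<le> expectation (\<lambda>w. ?r\<^sup>2 * (?n w)\<^sup>2)"
    by (rule integral_mono[OF integrable_gap_square _ sq_le]) (simp add: integrable_grad_norm)
  also have "\<dots> = ?r\<^sup>2 * expectation (\<lambda>w. (?n w)\<^sup>2)" by simp
  finally have "(\<phi> k)\<^sup>2 / (2 * ?r\<^sup>2) \<le> 1/2 * expectation (\<lambda>w. (?n w)\<^sup>2)"
    using R_pos by (simp add: field_simps)
  then show "\<phi> (Suc k) \<le> \<phi> k - (\<phi> k)\<^sup>2 / (2 * ?r\<^sup>2)"
    using expected_descent[of k] by (simp add: \<phi>_def)
qed

text \<open>
  A vanishing radius would force the gap at \<open>x0\<close> to be zero.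
\<close>

lemma level_radius_pos:
  assumes R: "R = level_radius f A b (mean_Z A M D) x0" "R < \<infinity>"
    and not_opt: "opt_val f A b < f x0"
  shows "0 < real_of_ereal R"
proof -
  note gap = suboptimality_gap_le[OF differentiable convex R start order_refl]
  have "real_of_ereal R \<noteq> 0" using gap(2) not_opt by auto
  then show ?thesis using gap(1) by simp
qed

end

theorem theorem3p2:
  fixes f :: "real^'n \<Rightarrow> real" and A :: "real^'n^'m" and b :: "real^'m"
    and M :: "real^'n^'n" and x0 :: "real^'n"
    and D :: "real mat measure"
    and \<Omega> :: "'w measure" and S :: "nat \<Rightarrow> 'w \<Rightarrow> real mat"
    and R :: ereal and k :: nat
  assumes dims: "CARD('m) < CARD('n)"
    and differentiable: "\<And>x. f differentiable (at x)"
    and convex: "convex_on UNIV f"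
    and start: "x0 \<in> feasible A b"
    and attained: "\<exists>xs\<in>feasible A b. \<forall>x\<in>feasible A b. f xs \<le> f x"
    and M_sym: "Finite_Cartesian_Product.transpose M = M"
    and M_psd: "\<And>u. 0 \<le> u \<bullet> (M *v u)"
    and M_pd: "pos_def_on_ker A M"
    and smooth: "smooth_wrt f M (feasible A b)"
    and D_prob: "prob_space D"
    and D_rows: "space D \<subseteq> {T. dim_row T = CARD('n)}"
    and Z_integrable: "integrable D (\<lambda>T. sketch_Z A M T)"
    and Z_pd: "pos_def_on_ker A (mean_Z A M D)"
    and \<Omega>_prob: "prob_space \<Omega>"
    and S_indep: "prob_space.indep_vars \<Omega> (\<lambda>_. D) S UNIV"
    and S_distr: "\<And>i. distr \<Omega> D (S i) = D"
    and R_def: "R = level_radius f A b (mean_Z A M D) x0"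
    and R_finite: "R < \<infinity>"
    and not_opt: "opt_val f A b < f x0"
  shows "(\<integral>w. f (rsd f A M x0 (\<lambda>i. S i w) k) \<partial>\<Omega>) - opt_val f A b
    \<le> 2 * (real_of_ereal R)\<^sup>2
        / (real k + 2 * (real_of_ereal R)\<^sup>2 / (f x0 - opt_val f A b))"
proof -
  interpret random_sketch_descent f A b M x0 D \<Omega> S
    by (intro random_sketch_descent.intro sketch_descent.intro random_sketch_descent_axioms.intro
        \<Omega>_prob assms)
  define \<phi> where "\<phi> k = expectation (\<lambda>w. f (iterate k w)) - opt_val f A b" for k
  have \<phi>0: "\<phi> 0 = f x0 - opt_val f A b"
    by (simp add: \<phi>_def iterate_def prob_space)
  have r: "0 < real_of_ereal R" by (rule level_radius_pos[OF R_def R_finite not_opt])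
  have "\<phi> k \<le> 2 * (real_of_ereal R)\<^sup>2 / (real k + 2 * (real_of_ereal R)\<^sup>2 / \<phi> 0)"
    using expected_gap_recurrence[OF R_def R_finite r] not_opt r
    by (intro quadratic_descent_rate) (simp_all add: \<phi>_def iterate_def prob_space)
  then show ?thesis unfolding \<phi>0 by (simp add: \<phi>_def iterate_def)
qed

end
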